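(* Let $G=N\rtimes Q$ and $H=M\rtimes R$, where $M$ is a normal subgroup of $N$ and $R$ is a subgroup of $Q$ which normalizes $M$, and suppose $(G,H)$ is a Hecke pair. Then the following are equivalent: (i) $(G,H)$ is reduced; (ii) $M_Q=\{e\}$ and $R_{N,\{e\}}\cap R_Q=\{e\}$.
   Context: $G=N\rtimes Q$ is an internal semidirect product of a normal subgroup $N$ by a subgroup $Q$ ($N\cap Q=\{e\}$, $NQ=G$), and $H=MR$. A Hecke pair $(G,H)$ is a group $G$ with a subgroup $H$ such that every double coset $HxH$ is a finite union of left cosets; it is reduced if $\bigcap_{x\in G}xHx^{-1}=\{e\}$. For a subgroup $K$ of $G$ and $x\in G$, $K_x=K\cap xKx^{-1}$, and $K_E=\bigcap_{x\in E}K_x$ for $E\subset G$; thus $M_Q=\bigcap_{q\in Q}(M\cap qMq^{-1})$ and $R_Q=\bigcap_{q\in Q}(R\cap qRq^{-1})$. For subgroups $T,K$ of $G$, $T_{x,K}=\{t\in T\mid txKt^{-1}=xK\}$ and $T_{E,K}=\bigcap_{x\in E}T_{x,K}$; thus $R_{N,\{e\}}=\{r\in R\mid rnr^{-1}=n\text{ for all }n\in N\}$. *)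

theory Defs
  imports "HOL-Algebra.Coset" "HOL-Algebra.Group_Action"
begin

definition internal_semidirect ::
  "('a, 'b) monoid_scheme \<Rightarrow> 'a set \<Rightarrow> 'a set \<Rightarrow> bool" where
  "internal_semidirect G N Q \<longleftrightarrow>
     group G \<and> N \<lhd> G \<and> subgroup Q G \<and> N \<inter> Q = {\<one>\<^bsub>G\<^esub>} \<and> N <#>\<^bsub>G\<^esub> Q = carrier G"

definition double_coset ::
  "('a, 'b) monoid_scheme \<Rightarrow> 'a set \<Rightarrow> 'a \<Rightarrow> 'a set" where
  "double_coset G H x = H <#>\<^bsub>G\<^esub> (x <#\<^bsub>G\<^esub> H)"

definition Hecke_pair ::
  "('a, 'b) monoid_scheme \<Rightarrow> 'a set \<Rightarrow> bool" where
  "Hecke_pair G H \<longleftrightarrow>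
     group G \<and> subgroup H G \<and>
     (\<forall>x\<in>carrier G. \<exists>F. finite F \<and> F \<subseteq> carrier G \<and>
        double_coset G H x = (\<Union>y\<in>F. y <#\<^bsub>G\<^esub> H))"

definition conjugate ::
  "('a, 'b) monoid_scheme \<Rightarrow> 'a set \<Rightarrow> 'a \<Rightarrow> 'a set" where
  "conjugate G K x = (x <#\<^bsub>G\<^esub> K) #>\<^bsub>G\<^esub> inv\<^bsub>G\<^esub> x"

definition reduced ::
  "('a, 'b) monoid_scheme \<Rightarrow> 'a set \<Rightarrow> bool" where
  "reduced G H \<longleftrightarrow> (\<Inter>x\<in>carrier G. conjugate G H x) = {\<one>\<^bsub>G\<^esub>}"

(* K_x and K_E; K_E is only meaningful for nonempty E, since an empty
   intersection is the whole type. *)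
definition conj_int ::
  "('a, 'b) monoid_scheme \<Rightarrow> 'a set \<Rightarrow> 'a \<Rightarrow> 'a set" where
  "conj_int G K x = K \<inter> conjugate G K x"

definition conj_int_set ::
  "('a, 'b) monoid_scheme \<Rightarrow> 'a set \<Rightarrow> 'a set \<Rightarrow> 'a set" where
  "conj_int_set G K E = (\<Inter>x\<in>E. conj_int G K x)"

(* T_{x,K} and T_{E,K}, again for nonempty E. The condition t x K t^{-1} = x K
   is an equality of sets; for K = {e} it says that t commutes with x. *)
definition coset_fixer ::
  "('a, 'b) monoid_scheme \<Rightarrow> 'a set \<Rightarrow> 'a \<Rightarrow> 'a set \<Rightarrow> 'a set" where
  "coset_fixer G T x K = {t \<in> T. conjugate G (x <#\<^bsub>G\<^esub> K) t = x <#\<^bsub>G\<^esub> K}"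

definition coset_fixer_set ::
  "('a, 'b) monoid_scheme \<Rightarrow> 'a set \<Rightarrow> 'a set \<Rightarrow> 'a set \<Rightarrow> 'a set" where
  "coset_fixer_set G T E K = (\<Inter>x\<in>E. coset_fixer G T x K)"

end

theory Submission
  imports Defs
begin

text \<open>
  Both groups in (ii) are contained in \<open>H\<close> and normal in \<open>G\<close>, so they vanish if the
  core \<open>K\<close> of \<open>H\<close> does. Conversely, decompose \<open>x \<in> K\<close> as \<open>x = m r\<close>. For \<open>q \<in> Q\<close>
  the conjugate of \<open>x\<close> by \<open>q\<close> lies in \<open>M R\<close>, and uniqueness of decompositions in
  \<open>N Q\<close> puts the conjugates of \<open>m\<close> in \<open>M\<close> and those of \<open>r\<close> in \<open>R\<close>. Hence
  \<open>m \<in> M\<^sub>Q\<close> is trivial and \<open>x = r \<in> R\<^sub>Q\<close>. In particular \<open>K \<subseteq> Q\<close>, and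
  since \<open>K\<close> and \<open>N\<close> are normal with trivial intersection, they commute.
\<close>

context group
begin

lemma mem_conjugate_iff:
  assumes "K \<subseteq> carrier G" "x \<in> carrier G"
  shows "y \<in> conjugate G K x \<longleftrightarrow> y \<in> carrier G \<and> inv x \<otimes> y \<otimes> x \<in> K"
proof
  assume "y \<in> conjugate G K x"
  then obtain k where k: "k \<in> K" "y = x \<otimes> k \<otimes> inv x"
    by (auto simp: conjugate_def l_coset_def r_coset_def)
  with assms have "k \<in> carrier G" by auto
  with k assms have "inv x \<otimes> y \<otimes> x = k" "y \<in> carrier G"
    by (simp_all add: m_assoc inv_solve_left')
  with k show "y \<in> carrier G \<and> inv x \<otimes> y \<otimes> x \<in> K" by simp
next
  assume y: "y \<in> carrier G \<and> inv x \<otimes> y \<otimes> x \<in> K"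
  with assms have "x \<otimes> (inv x \<otimes> y) = y"
    by (simp flip: m_assoc)
  with y assms have "y = x \<otimes> (inv x \<otimes> y \<otimes> x) \<otimes> inv x"
    by (simp add: m_assoc)
  with y show "y \<in> conjugate G K x"
    by (auto simp: conjugate_def l_coset_def r_coset_def)
qed

text \<open>The identity always lies in the core, so being reduced amounts to one inclusion, which
  can be checked element by element.\<close>

lemma reduced_iff:
  assumes "subgroup H G"
  shows "reduced G H \<longleftrightarrow>
    (\<forall>y\<in>carrier G. (\<forall>x\<in>carrier G. inv x \<otimes> y \<otimes> x \<in> H) \<longrightarrow> y = \<one>)"
proof -
  have "(\<Inter>x\<in>carrier G. conjugate G H x) =
      {y \<in> carrier G. \<forall>x\<in>carrier G. inv x \<otimes> y \<otimes> x \<in> H}"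
    \<comment> \<open>Membership in \<open>carrier G\<close> is read off from the conjugate at
      \<open>\<one>\<close>; this is the purpose of the \<open>bspec\<close> instance.\<close>
    using assms by (auto simp: mem_conjugate_iff subgroup.subset intro: bspec[OF _ one_closed, THEN conjunct1])
  moreover have "\<one> \<in> {y \<in> carrier G. \<forall>x\<in>carrier G. inv x \<otimes> y \<otimes> x \<in> H}"
    using assms by (simp add: subgroup.one_closed)
  ultimately show ?thesis
    unfolding reduced_def by blast
qed

text \<open>Since \<open>\<one> \<in> E\<close>, the requirement \<open>y \<in> K\<close> is the
  case \<open>x = \<one>\<close> of the condition on conjugates, so the intersection with
  \<open>K\<close> is absorbed.\<close>

lemma mem_conj_int_set_iff:
  assumes "K \<subseteq> carrier G" "subgroup E G"
  shows "y \<in> conj_int_set G K E \<longleftrightarrow> y \<in> carrier G \<and> (\<forall>x\<in>E. inv x \<otimes> y \<otimes> x \<in> K)"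
proof -
  have E: "E \<subseteq> carrier G" "\<one> \<in> E"
    using assms(2) by (simp_all add: subgroup.subset subgroup.one_closed)
  have "y \<in> conj_int_set G K E \<longleftrightarrow>
      y \<in> K \<and> (\<forall>x\<in>E. y \<in> carrier G \<and> inv x \<otimes> y \<otimes> x \<in> K)"
    using E assms(1) by (auto simp: conj_int_set_def conj_int_def mem_conjugate_iff subset_iff)
  also have "\<dots> \<longleftrightarrow> y \<in> carrier G \<and> (\<forall>x\<in>E. inv x \<otimes> y \<otimes> x \<in> K)"
    using E assms(1) by force
  finally show ?thesis .
qed

text \<open>The coset of \<open>x\<close> is the singleton of \<open>x\<close>, so fixing it means
  commuting with \<open>x\<close>. Membership in \<open>T\<close> has to come from some index, hence
  \<open>E \<noteq> {}\<close>.\<close>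

lemma mem_coset_fixer_set_one_iff:
  assumes "T \<subseteq> carrier G" "E \<subseteq> carrier G" "E \<noteq> {}"
  shows "t \<in> coset_fixer_set G T E {\<one>} \<longleftrightarrow> t \<in> T \<and> (\<forall>x\<in>E. t \<otimes> x = x \<otimes> t)"
proof -
  have "t \<in> coset_fixer G T x {\<one>} \<longleftrightarrow> t \<in> T \<and> t \<otimes> x = x \<otimes> t" if "x \<in> E" for x
  proof (cases "t \<in> T")
    case True
    with that assms have "t \<in> carrier G" "x \<in> carrier G" by auto
    then show ?thesis
      by (auto simp: coset_fixer_def conjugate_def l_coset_def r_coset_def inv_solve_right')
  qed (simp add: coset_fixer_def)
  with assms(3) show ?thesis
    by (auto simp: coset_fixer_set_def)
qed

text \<open>Moving the factors from \<open>N\<close> to one side and those from \<open>Q\<close> to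
  the other gives an element of the trivial intersection.\<close>

lemma complement_decomposition_unique:
  assumes "subgroup N G" "subgroup Q G" "N \<inter> Q = {\<one>}"
    and "n \<in> N" "n' \<in> N" "q \<in> Q" "q' \<in> Q" "n \<otimes> q = n' \<otimes> q'"
  shows "n = n' \<and> q = q'"
proof -
  have carr: "n \<in> carrier G" "n' \<in> carrier G" "q \<in> carrier G" "q' \<in> carrier G"
    using assms by (auto dest: subgroup.mem_carrier)
  have "inv n' \<otimes> n = q' \<otimes> inv q"
  proof -
    have "inv n' \<otimes> (n \<otimes> q) \<otimes> inv q = inv n' \<otimes> (n' \<otimes> q') \<otimes> inv q"
      using assms(8) by simp
    then show ?thesis
      using carr by (simp add: m_assoc inv_solve_left')
  qed
  moreover have "inv n' \<otimes> n \<in> N" "q' \<otimes> inv q \<in> Q"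
    using assms by (simp_all add: subgroup.m_closed subgroup.m_inv_closed)
  ultimately have "inv n' \<otimes> n = \<one>" "q' \<otimes> inv q = \<one>"
    using assms(3) by auto
  then show ?thesis
    using carr by (simp add: inv_solve_left' inv_solve_right')
qed

lemma commute_if_commutator_one:
  assumes "x \<in> carrier G" "y \<in> carrier G" "inv x \<otimes> (inv y \<otimes> x \<otimes> y) = \<one>"
  shows "x \<otimes> y = y \<otimes> x"
  using assms by (simp add: m_assoc inv_solve_left')

end

theorem proposition2p6:
  fixes G :: "('a, 'b) monoid_scheme" and N Q M R H :: "'a set"
  assumes "group G"
    and "internal_semidirect G N Q"
    and "M \<lhd> (G\<lparr>carrier := N\<rparr>)"
    and "subgroup R (G\<lparr>carrier := Q\<rparr>)"
    and "R \<subseteq> normalizer G M"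
    and "H = M <#>\<^bsub>G\<^esub> R"
    and "Hecke_pair G H"
  shows "reduced G H \<longleftrightarrow>
    conj_int_set G M Q = {\<one>\<^bsub>G\<^esub>} \<and>
    coset_fixer_set G R N {\<one>\<^bsub>G\<^esub>} \<inter> conj_int_set G R Q = {\<one>\<^bsub>G\<^esub>}"
proof -
  interpret group G by fact
  have "N \<lhd> G" and Q: "subgroup Q G" and NQ: "N \<inter> Q = {\<one>\<^bsub>G\<^esub>}" "N <#>\<^bsub>G\<^esub> Q = carrier G"
    using assms(2) by (auto simp: internal_semidirect_def)
  interpret N: normal N G by fact
  interpret Q: subgroup Q G by fact
  have N: "subgroup N G" by (rule N.subgroup_axioms)
  have MN: "subgroup M (G\<lparr>carrier := N\<rparr>)"
    using assms(3) by (rule normal_imp_subgroup)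
  interpret M: subgroup M G
    using N MN by (rule incl_subgroup)
  interpret R: subgroup R G
    using Q assms(4) by (rule incl_subgroup)
  interpret H: subgroup H G
    using assms(7) by (simp add: Hecke_pair_def)
  have sub: "M \<subseteq> N" "R \<subseteq> Q"
    using subgroup.subset[OF MN] subgroup.subset[OF assms(4)] by simp_all
  \<comment> \<open>Normality of \<open>M\<close> is stated inside \<open>N\<close>, so inverses
    taken in \<open>N\<close> must be identified with those of \<open>G\<close>.\<close>
  have M_conj: "inv\<^bsub>G\<^esub> n \<otimes>\<^bsub>G\<^esub> m \<otimes>\<^bsub>G\<^esub> n \<in> M" if "n \<in> N" "m \<in> M" for n m
    using normal.inv_op_closed1[OF assms(3), of n m] that N m_inv_consistent[of N n] by simp
  have H_iff: "x \<in> H \<longleftrightarrow> (\<exists>m\<in>M. \<exists>r\<in>R. x = m \<otimes>\<^bsub>G\<^esub> r)" for x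
    unfolding assms(6) by (auto simp: set_mult_def)
  have MH: "m \<in> H" if "m \<in> M" for m
    unfolding H_iff using that by (metis M.mem_carrier R.one_closed r_one)
  have RH: "r \<in> H" if "r \<in> R" for r
    unfolding H_iff using that by (metis R.mem_carrier M.one_closed l_one)
  \<comment> \<open>Conjugation by \<open>a\<close> acts first. The order of the factors of
    \<open>g\<close> therefore decides whether \<open>N\<close> or \<open>Q\<close> acts first on
    \<open>x\<close>.\<close>
  have conj_mult: "inv\<^bsub>G\<^esub> (a \<otimes>\<^bsub>G\<^esub> b) \<otimes>\<^bsub>G\<^esub> x \<otimes>\<^bsub>G\<^esub> (a \<otimes>\<^bsub>G\<^esub> b) =
      inv\<^bsub>G\<^esub> b \<otimes>\<^bsub>G\<^esub> (inv\<^bsub>G\<^esub> a \<otimes>\<^bsub>G\<^esub> x \<otimes>\<^bsub>G\<^esub> a) \<otimes>\<^bsub>G\<^esub> b"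
    if "a \<in> carrier G" "b \<in> carrier G" "x \<in> carrier G" for a b x
    using that by (simp add: inv_mult_group m_assoc)
  have NQ_split: "\<exists>n\<in>N. \<exists>q\<in>Q. g = n \<otimes>\<^bsub>G\<^esub> q" if "g \<in> carrier G" for g
    using that unfolding NQ(2)[symmetric] by (auto simp: set_mult_def)
  have QN_split: "\<exists>n\<in>N. \<exists>q\<in>Q. g = q \<otimes>\<^bsub>G\<^esub> n" if g: "g \<in> carrier G" for g
  proof -
    obtain n q where "n \<in> N" "q \<in> Q" "inv\<^bsub>G\<^esub> g = n \<otimes>\<^bsub>G\<^esub> q"
      using NQ_split[of "inv\<^bsub>G\<^esub> g"] g by auto
    moreover from this have "g = inv\<^bsub>G\<^esub> q \<otimes>\<^bsub>G\<^esub> inv\<^bsub>G\<^esub> n"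
      using g by (metis inv_inv inv_mult_group N.mem_carrier Q.mem_carrier)
    ultimately show ?thesis
      using N.m_inv_closed Q.m_inv_closed by blast
  qed
  note M_iff = mem_conj_int_set_iff[OF M.subset Q]
  note R_iff = mem_conj_int_set_iff[OF R.subset Q]
  have "N \<noteq> {}"
    using N.one_closed by blast
  note fix_iff = mem_coset_fixer_set_one_iff[OF R.subset N.subset this]
  note red_iff = reduced_iff[OF H.subgroup_axioms]
  show ?thesis
  proof
    assume red: "reduced G H"
    have "x = \<one>\<^bsub>G\<^esub>" if x: "x \<in> conj_int_set G M Q" for x
    proof -
      have xG: "x \<in> carrier G"
        using x by (simp add: M_iff)
      have "inv\<^bsub>G\<^esub> g \<otimes>\<^bsub>G\<^esub> x \<otimes>\<^bsub>G\<^esub> g \<in> H" if g: "g \<in> carrier G" for g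
      proof -
        \<comment> \<open>Here \<open>q\<close> must act first: it sends \<open>x\<close> into
          \<open>M\<close> by the choice of \<open>x\<close>, and then \<open>n\<close> preserves
          \<open>M\<close>.\<close>
        obtain n q where "n \<in> N" "q \<in> Q" "g = q \<otimes>\<^bsub>G\<^esub> n"
          using QN_split[OF g] by blast
        then show ?thesis
          using x xG by (simp add: conj_mult M_conj MH M_iff)
      qed
      with red xG show ?thesis by (simp add: red_iff)
    qed
    moreover have "\<one>\<^bsub>G\<^esub> \<in> conj_int_set G M Q"
      by (simp add: M_iff)
    moreover have "x = \<one>\<^bsub>G\<^esub>"
      if x: "x \<in> coset_fixer_set G R N {\<one>\<^bsub>G\<^esub>}" "x \<in> conj_int_set G R Q" for x
    proof -
      have xG: "x \<in> carrier G"
        using x by (simp add: R_iff)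
      have "inv\<^bsub>G\<^esub> g \<otimes>\<^bsub>G\<^esub> x \<otimes>\<^bsub>G\<^esub> g \<in> H" if g: "g \<in> carrier G" for g
      proof -
        \<comment> \<open>Here \<open>n\<close> acts first: it fixes \<open>x\<close>, and then
          \<open>q\<close> sends \<open>x\<close> into \<open>R\<close>.\<close>
        obtain n q where nq: "n \<in> N" "q \<in> Q" "g = n \<otimes>\<^bsub>G\<^esub> q"
          using NQ_split[OF g] by blast
        have "inv\<^bsub>G\<^esub> n \<otimes>\<^bsub>G\<^esub> x \<otimes>\<^bsub>G\<^esub> n = x"
          using x(1) nq(1) xG by (simp add: fix_iff m_assoc inv_solve_left')
        then show ?thesis
          using x nq xG by (simp add: conj_mult RH R_iff)
      qed
      with red xG show ?thesis by (simp add: red_iff)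
    qed
    moreover have "\<one>\<^bsub>G\<^esub> \<in> coset_fixer_set G R N {\<one>\<^bsub>G\<^esub>} \<inter> conj_int_set G R Q"
      by (simp add: R_iff fix_iff)
    ultimately show "conj_int_set G M Q = {\<one>\<^bsub>G\<^esub>} \<and>
        coset_fixer_set G R N {\<one>\<^bsub>G\<^esub>} \<inter> conj_int_set G R Q = {\<one>\<^bsub>G\<^esub>}"
      by blast
  next
    assume triv: "conj_int_set G M Q = {\<one>\<^bsub>G\<^esub>} \<and>
        coset_fixer_set G R N {\<one>\<^bsub>G\<^esub>} \<inter> conj_int_set G R Q = {\<one>\<^bsub>G\<^esub>}"
    \<comment> \<open>Stated for every element of the core, because it is applied below both to
      \<open>x\<close> and to its conjugates by elements of \<open>N\<close>.\<close>
    have core: "x \<in> R \<and> x \<in> conj_int_set G R Q"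
      if xG: "x \<in> carrier G" and x: "\<And>g. g \<in> carrier G \<Longrightarrow> inv\<^bsub>G\<^esub> g \<otimes>\<^bsub>G\<^esub> x \<otimes>\<^bsub>G\<^esub> g \<in> H" for x
    proof -
      have "x \<in> H"
        using x[of "\<one>\<^bsub>G\<^esub>"] xG by simp
      then obtain m r where mr: "m \<in> M" "r \<in> R" "x = m \<otimes>\<^bsub>G\<^esub> r"
        by (auto simp: H_iff)
      have mrQ: "inv\<^bsub>G\<^esub> q \<otimes>\<^bsub>G\<^esub> m \<otimes>\<^bsub>G\<^esub> q \<in> M \<and> inv\<^bsub>G\<^esub> q \<otimes>\<^bsub>G\<^esub> r \<otimes>\<^bsub>G\<^esub> q \<in> R"
        if q: "q \<in> Q" for q
      proof -
        obtain m' r' where m'r': "m' \<in> M" "r' \<in> R"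
            "inv\<^bsub>G\<^esub> q \<otimes>\<^bsub>G\<^esub> x \<otimes>\<^bsub>G\<^esub> q = m' \<otimes>\<^bsub>G\<^esub> r'"
          using x[of q] q by (auto simp: H_iff)
        \<comment> \<open>This cancellation, in right-associated form, lets \<open>simp\<close>
          split the conjugate of \<open>m r\<close> into the product of the two conjugates.\<close>
        have "q \<otimes>\<^bsub>G\<^esub> (inv\<^bsub>G\<^esub> q \<otimes>\<^bsub>G\<^esub> (r \<otimes>\<^bsub>G\<^esub> q)) = r \<otimes>\<^bsub>G\<^esub> q"
          using mr q by (simp add: m_assoc[symmetric])
        then have "(inv\<^bsub>G\<^esub> q \<otimes>\<^bsub>G\<^esub> m \<otimes>\<^bsub>G\<^esub> q) \<otimes>\<^bsub>G\<^esub> (inv\<^bsub>G\<^esub> q \<otimes>\<^bsub>G\<^esub> r \<otimes>\<^bsub>G\<^esub> q) = m' \<otimes>\<^bsub>G\<^esub> r'"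
          using m'r'(3) mr q by (simp add: m_assoc)
        moreover have "inv\<^bsub>G\<^esub> q \<otimes>\<^bsub>G\<^esub> m \<otimes>\<^bsub>G\<^esub> q \<in> N" "inv\<^bsub>G\<^esub> q \<otimes>\<^bsub>G\<^esub> r \<otimes>\<^bsub>G\<^esub> q \<in> Q"
          using mr q sub by (auto intro: N.inv_op_closed1)
        ultimately have "inv\<^bsub>G\<^esub> q \<otimes>\<^bsub>G\<^esub> m \<otimes>\<^bsub>G\<^esub> q = m' \<and> inv\<^bsub>G\<^esub> q \<otimes>\<^bsub>G\<^esub> r \<otimes>\<^bsub>G\<^esub> q = r'"
          using m'r' sub by (intro complement_decomposition_unique[OF N Q NQ(1)]) auto
        with m'r' show ?thesis by simp
      qed
      then have "m \<in> conj_int_set G M Q"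
        using mr by (simp add: M_iff)
      then have "m = \<one>\<^bsub>G\<^esub>"
        using triv by blast
      then have "x = r"
        using mr by simp
      with mr mrQ show ?thesis by (simp add: R_iff)
    qed
    show "reduced G H"
      unfolding red_iff
    proof (intro ballI impI)
      fix x assume xG: "x \<in> carrier G"
        and "\<forall>g\<in>carrier G. inv\<^bsub>G\<^esub> g \<otimes>\<^bsub>G\<^esub> x \<otimes>\<^bsub>G\<^esub> g \<in> H"
      then have x: "\<And>g. g \<in> carrier G \<Longrightarrow> inv\<^bsub>G\<^esub> g \<otimes>\<^bsub>G\<^esub> x \<otimes>\<^bsub>G\<^esub> g \<in> H" by blast
      have xR: "x \<in> R" "x \<in> conj_int_set G R Q"
        using core[OF xG x] by simp_all
      have "x \<otimes>\<^bsub>G\<^esub> n = n \<otimes>\<^bsub>G\<^esub> x" if n: "n \<in> N" for n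
      proof (rule commute_if_commutator_one)
        have nG: "n \<in> carrier G"
          using n by simp
        \<comment> \<open>The conjugate of \<open>x\<close> by \<open>n\<close> is again in the
          core: conjugating it further by \<open>g\<close> is conjugating \<open>x\<close> by the
          product of \<open>n\<close> and \<open>g\<close>.\<close>
        have "inv\<^bsub>G\<^esub> g \<otimes>\<^bsub>G\<^esub> (inv\<^bsub>G\<^esub> n \<otimes>\<^bsub>G\<^esub> x \<otimes>\<^bsub>G\<^esub> n) \<otimes>\<^bsub>G\<^esub> g \<in> H" if "g \<in> carrier G" for g
          using x[of "n \<otimes>\<^bsub>G\<^esub> g"] that nG xG by (simp add: conj_mult)
        then have "inv\<^bsub>G\<^esub> n \<otimes>\<^bsub>G\<^esub> x \<otimes>\<^bsub>G\<^esub> n \<in> R"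
          using core[of "inv\<^bsub>G\<^esub> n \<otimes>\<^bsub>G\<^esub> x \<otimes>\<^bsub>G\<^esub> n"] xG nG by simp
        with xR have "inv\<^bsub>G\<^esub> x \<otimes>\<^bsub>G\<^esub> (inv\<^bsub>G\<^esub> n \<otimes>\<^bsub>G\<^esub> x \<otimes>\<^bsub>G\<^esub> n) \<in> Q"
          using sub by auto
        \<comment> \<open>Bracketed the other way, the commutator is a conjugate of the inverse of
          \<open>n\<close> times \<open>n\<close>, so it lies in the normal subgroup
          \<open>N\<close>; above, it was a product of two elements of \<open>Q\<close>.\<close>
        moreover have "inv\<^bsub>G\<^esub> x \<otimes>\<^bsub>G\<^esub> inv\<^bsub>G\<^esub> n \<otimes>\<^bsub>G\<^esub> x \<otimes>\<^bsub>G\<^esub> n \<in> N"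
          using n xG by (intro N.m_closed N.inv_op_closed1) auto
        then have "inv\<^bsub>G\<^esub> x \<otimes>\<^bsub>G\<^esub> (inv\<^bsub>G\<^esub> n \<otimes>\<^bsub>G\<^esub> x \<otimes>\<^bsub>G\<^esub> n) \<in> N"
          using xG nG by (simp add: m_assoc)
        ultimately show "inv\<^bsub>G\<^esub> x \<otimes>\<^bsub>G\<^esub> (inv\<^bsub>G\<^esub> n \<otimes>\<^bsub>G\<^esub> x \<otimes>\<^bsub>G\<^esub> n) = \<one>\<^bsub>G\<^esub>"
          using NQ(1) by blast
      qed (use n xG in simp_all)
      with xR have "x \<in> coset_fixer_set G R N {\<one>\<^bsub>G\<^esub>} \<inter> conj_int_set G R Q"
        by (simp add: fix_iff)
      with triv show "x = \<one>\<^bsub>G\<^esub>" by blast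
    qed
  qed
qed

end
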